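(* Assume $(u_-,h_-)\in\Omega$, $u_-<u_+=u^A(h_+)$, $h_-<h_+$ and $u^D(h_-)\le u_-<u^A(h_-)$. Put $v_\pm=v(u_\pm,h_\pm)$. If in the interval $(u_-,u_+)$ the chord condition $$\frac{v_+-v_-}{u_+-u_-}>\frac{v-v_-}{u-u_-}$$ is satisfied for $v=v(u,h_-)$ and for $v=v^A(u)$ (the latter where $v^A(u)$ is defined), then there is a traveling wave connecting $(u_-,h_-)$ with $(u_+,h_+)$.
   Context: Setting (a one-lane traffic model with hysteresis, in Lagrangian coordinates). $u\in[1,\infty)$ is the spacing between vehicles and $h\in[1,\infty)$ is a hysteresis parameter. Given are smooth functions: the acceleration curve $v=v^A(u)$, $u\ge u_0^A$, with $u_0^A>1$ and $v^A(u_0^A)=0$; the deceleration curve $v=v^D(u)$, $u\ge 1$, with $v^D(1)=0$; both are positive apart from these zeros and tend to a common maximum speed $\bar v>0$ as $u\to\infty$. The two curves intersect at exactly one point $u=u_c$; $v^A$ lies below $v^D$ for $u<u_c$ (congested zone) and above $v^D$ for $u>u_c$ (free zone). Also given is a family of scanning curves $v=v^S(u,h)$, one for each value of $h$. Through each point of the acceleration curve and through each point of the deceleration curve there passes a scanning curve. $u^A(h)$ and $u^D(h)$ denote the $u$-coordinates of the intersections of the scanning curve $v=v^S(\cdot,h)$ with $v=v^A(u)$ and $v=v^D(u)$ respectively, so that $v^S(u^A(h),h)=v^A(u^A(h))$ and $v^S(u^D(h),h)=v^D(u^D(h))$. The functions $u^A,u^D$ are invertible, with inverse functions $h^A(u)$,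 $h^D(u)$, and $h_c:=h^A(u_c)=h^D(u_c)$. Put $$\Omega=\{(u,h)\in[1,\infty)\times[1,\infty): u^D(h)\le u\le u^A(h)\}.$$ Standing assumption: $v^A_u>0$, $v^D_u>0$, $v^S_u(u,h)>0$, $v^S_h(u,h)>0$; $u^A(h)\ge u^D(h)$, with equality if and only if $h=h_c$; and $v^A_{uu}<0$, $v^D_{uu}<0$, and $v^S_{uu}(u,h)<0$ for $(u,h)\in\Omega$. The velocity is $$v(u,h)=\begin{cases}v^D(u)& u\le u^D(h),\\ v^S(u,h)& u^D(h)<u<u^A(h),\\ v^A(u)& u\ge u^A(h).\end{cases}$$ Traveling wave (viscous shock profile) connecting $(u_-,h_-)$ with $(u_+,h_+)$, where $u_-\ne u_+$: with $v_\pm=v(u_\pm,h_\pm)$ and $s=-\frac{v_+-v_-}{u_+-u_-}$, a pair of functions $(u,h)(\xi)$, $\xi\in\mathbb{R}$, satisfying $$u'=-s(u-u_\pm)-(v(u,h)-v_\pm),\qquad s h'=s\chi(A)\,(h^A(u))'+s\chi(D)\,(h^D(u))',$$ $$(u,h)(\pm\infty)=(u_\pm,h_\pm),\qquad (u',h')(\pm\infty)=(0,0),$$ where $'=d/d\xi$, $A=\{su'<0 \text{ and } u=u^A(h)\}$, $D=\{su'>0\text{ and }u=u^D(h)\}$, and $\chi(E)=1$ if $E$ is true, $0$ otherwise.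
   Formalization: The signs of v^S_u, v^S_uu, v^S_h are assumed only inside Ω, and v^S_h>0 only for h<h_c, as they are contradictory otherwise; h^A, h^D are C^1 on each side of u_c; the wave stays in Ω with h continuous and its equation holding off finitely many points, as h has a kink on reaching the curve. *)

theory Defs
  imports "HOL-Analysis.Analysis"
begin

text \<open>Derivative relative to an interval: one-sided at an endpoint that belongs to the interval.\<close>

definition deriv_on :: "real set \<Rightarrow> (real \<Rightarrow> real) \<Rightarrow> real \<Rightarrow> real" where
  "deriv_on I f x = vector_derivative f (at x within I)"

definition smooth_on :: "real set \<Rightarrow> (real \<Rightarrow> real) \<Rightarrow> bool" where
  "smooth_on I f \<longleftrightarrow> (\<forall>n. \<forall>x\<in>I. ((deriv_on I ^^ n) f) differentiable (at x within I))"

definition C1_on :: "real set \<Rightarrow> (real \<Rightarrow> real) \<Rightarrow> bool" where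
  "C1_on I f \<longleftrightarrow> (\<forall>x\<in>I. f differentiable (at x within I)) \<and> continuous_on I (deriv_on I f)"

definition partial_u :: "(real \<Rightarrow> real \<Rightarrow> real) \<Rightarrow> real \<Rightarrow> real \<Rightarrow> real" where
  "partial_u F u h = deriv (\<lambda>x. F x h) u"

definition partial_h :: "(real \<Rightarrow> real \<Rightarrow> real) \<Rightarrow> real \<Rightarrow> real \<Rightarrow> real" where
  "partial_h F u h = deriv (\<lambda>y. F u y) h"

text \<open>Smoothness on an open subset of the plane: every iterated partial derivative, of any order
  and in any sequence of variables, is (Frechet) differentiable there.\<close>

definition smooth2_on :: "(real \<times> real) set \<Rightarrow> (real \<Rightarrow> real \<Rightarrow> real) \<Rightarrow> bool" where
  "smooth2_on W F \<longleftrightarrow>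
     (\<forall>ds. set ds \<subseteq> {partial_u, partial_h} \<longrightarrow>
        (\<lambda>(u, h). foldr (\<lambda>d G. d G) ds F u h) differentiable_on W)"

text \<open>The values of the functions outside their mathematical domains
  (\<open>u \<ge> u0A\<close> for \<open>vA\<close>, \<open>u \<ge> 1\<close> for \<open>vD\<close>, \<open>Omega\<close> for \<open>vS\<close>, \<open>h \<ge> 1\<close> for \<open>uA\<close> and \<open>uD\<close>)
  are irrelevant.\<close>

record traffic_model =
  u0A :: real
  vA :: "real \<Rightarrow> real"
  vD :: "real \<Rightarrow> real"
  vbar :: real
  uc :: real
  vS :: "real \<Rightarrow> real \<Rightarrow> real"
  uA :: "real \<Rightarrow> real"
  uD :: "real \<Rightarrow> real"

definition hA :: "traffic_model \<Rightarrow> real \<Rightarrow> real" where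
  "hA M = inv_into {1..} (uA M)"

definition hD :: "traffic_model \<Rightarrow> real \<Rightarrow> real" where
  "hD M = inv_into {1..} (uD M)"

definition hc :: "traffic_model \<Rightarrow> real" where
  "hc M = hA M (uc M)"

definition Omega :: "traffic_model \<Rightarrow> (real \<times> real) set" where
  "Omega M = {(u, h). 1 \<le> u \<and> 1 \<le> h \<and> uD M h \<le> u \<and> u \<le> uA M h}"

definition acceleration_deceleration_curves :: "traffic_model \<Rightarrow> bool" where
  "acceleration_deceleration_curves M \<longleftrightarrow>
     1 < u0A M \<and> 0 < vbar M \<and>
     smooth_on {u0A M..} (vA M) \<and> smooth_on {1..} (vD M) \<and>
     vA M (u0A M) = 0 \<and> vD M 1 = 0 \<and>
     (\<forall>u>u0A M. 0 < vA M u) \<and> (\<forall>u>1. 0 < vD M u) \<and>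
     (vA M \<longlongrightarrow> vbar M) at_top \<and> (vD M \<longlongrightarrow> vbar M) at_top \<and>
     u0A M \<le> uc M \<and> vA M (uc M) = vD M (uc M) \<and>
     (\<forall>u\<in>{u0A M..<uc M}. vA M u < vD M u) \<and>
     (\<forall>u>uc M. vD M u < vA M u)"

text \<open>There is one scanning curve for each \<open>h \<ge> 1\<close>. It meets the acceleration and the deceleration
  curve at \<open>uA h\<close> and \<open>uD h\<close>; that a scanning curve passes through each point of the two curves
  is the surjectivity contained in \<open>bij_betw\<close>.

  \<open>hA\<close> and \<open>hD\<close> are continuously differentiable up to \<open>uc\<close> in the congested and in the free zone,
  but may have a kink at \<open>uc\<close>: if the acceleration and the deceleration curve cross transversally,
  then \<open>uD \<le> uA\<close> and the monotonicity of the scanning curves exclude that both are differentiable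
  there with positive derivatives. For the same reason \<open>vS\<close> is smooth in the interior of \<open>Omega\<close>
  and continuous on \<open>Omega\<close>, which is pinched at \<open>(uc, hc)\<close>.\<close>

definition scanning_curves :: "traffic_model \<Rightarrow> bool" where
  "scanning_curves M \<longleftrightarrow>
     bij_betw (uA M) {1..} {u0A M..} \<and> bij_betw (uD M) {1..} {1..} \<and>
     (\<forall>h\<ge>1. vS M (uA M h) h = vA M (uA M h) \<and> vS M (uD M h) h = vD M (uD M h)) \<and>
     C1_on {u0A M..uc M} (hA M) \<and> C1_on {uc M..} (hA M) \<and>
     C1_on {1..uc M} (hD M) \<and> C1_on {uc M..} (hD M) \<and>
     hA M (uc M) = hD M (uc M) \<and>
     continuous_on (Omega M) (\<lambda>(u, h). vS M u h) \<and>
     smooth2_on (interior (Omega M)) (vS M)"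

text \<open>The inequalities for \<open>vS\<close> are imposed in the interior of \<open>Omega\<close>, because they cannot hold on
  the edge \<open>h = 1\<close>: that scanning curve joins \<open>(1, 0)\<close> to \<open>(u0A, 0)\<close> and so is not strictly increasing.

  The inequality \<open>vS_h > 0\<close> is imposed in the congested zone \<open>h < hc\<close> only; for \<open>h > hc\<close> it
  contradicts the rest. Indeed \<open>uA\<close> is an increasing homeomorphism, so each \<open>u\<close> below and near
  \<open>uA h\<close> is \<open>uA k\<close> for some \<open>k < h\<close>, and \<open>vS_h > 0\<close> would give
  \<open>vA u = vS u k < vS u h\<close>; letting \<open>u\<close> decrease to \<open>uD h\<close> yields \<open>vA (uD h) \<le> vD (uD h)\<close>,
  whereas \<open>vD < vA\<close> beyond \<open>uc\<close>.\<close>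

definition standing_assumption :: "traffic_model \<Rightarrow> bool" where
  "standing_assumption M \<longleftrightarrow>
     (\<forall>u\<ge>u0A M. 0 < deriv_on {u0A M..} (vA M) u) \<and>
     (\<forall>u\<ge>1. 0 < deriv_on {1..} (vD M) u) \<and>
     (\<forall>(u, h)\<in>interior (Omega M). 0 < partial_u (vS M) u h) \<and>
     (\<forall>(u, h)\<in>interior (Omega M). h < hc M \<longrightarrow> 0 < partial_h (vS M) u h) \<and>
     (\<forall>h\<ge>1. uD M h \<le> uA M h \<and> (uA M h = uD M h \<longleftrightarrow> h = hc M)) \<and>
     (\<forall>u\<ge>u0A M. (deriv_on {u0A M..} ^^ 2) (vA M) u < 0) \<and>
     (\<forall>u\<ge>1. (deriv_on {1..} ^^ 2) (vD M) u < 0) \<and>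
     (\<forall>(u, h)\<in>interior (Omega M). partial_u (partial_u (vS M)) u h < 0)"

definition hysteresis_traffic_model :: "traffic_model \<Rightarrow> bool" where
  "hysteresis_traffic_model M \<longleftrightarrow>
     acceleration_deceleration_curves M \<and> scanning_curves M \<and> standing_assumption M"

definition velocity :: "traffic_model \<Rightarrow> real \<Rightarrow> real \<Rightarrow> real" where
  "velocity M u h =
     (if u \<le> uD M h then vD M u else if u < uA M h then vS M u h else vA M u)"

definition wave_speed :: "traffic_model \<Rightarrow> real \<times> real \<Rightarrow> real \<times> real \<Rightarrow> real" where
  "wave_speed M = (\<lambda>(um, hm) (up, hp). - (velocity M up hp - velocity M um hm) / (up - um))"

definition accelerating ::
  "traffic_model \<Rightarrow> real \<Rightarrow> (real \<Rightarrow> real) \<Rightarrow> (real \<Rightarrow> real) \<Rightarrow> real \<Rightarrow> bool" where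
  "accelerating M s u h x \<longleftrightarrow> s * deriv u x < 0 \<and> u x = uA M (h x)"

definition decelerating ::
  "traffic_model \<Rightarrow> real \<Rightarrow> (real \<Rightarrow> real) \<Rightarrow> (real \<Rightarrow> real) \<Rightarrow> real \<Rightarrow> bool" where
  "decelerating M s u h x \<longleftrightarrow> 0 < s * deriv u x \<and> u x = uD M (h x)"

text \<open>\<open>h\<close> is continuous and satisfies its equation up to finitely many points: a profile that
  arrives at the acceleration curve along a scanning curve and then follows it has a kink in \<open>h\<close>
  at the arrival, so no two-sided derivative exists there. The profile stays in \<open>Omega\<close>; without
  this an exceptional point could be used to cross the acceleration or the deceleration curve.\<close>

definition traveling_wave ::
  "traffic_model \<Rightarrow> real \<times> real \<Rightarrow> real \<times> real \<Rightarrow> (real \<Rightarrow> real) \<Rightarrow> (real \<Rightarrow> real) \<Rightarrow> bool" where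
  "traveling_wave M Pm Pp u h \<longleftrightarrow>
     (case (Pm, Pp) of ((um, hm), (up, hp)) \<Rightarrow>
        let s = wave_speed M (um, hm) (up, hp);
            vm = velocity M um hm;
            vp = velocity M up hp
        in um \<noteq> up \<and>
           (\<forall>x. (u x, h x) \<in> Omega M) \<and>
           (\<forall>x. u differentiable (at x) \<and>
                deriv u x = - s * (u x - um) - (velocity M (u x) (h x) - vm) \<and>
                deriv u x = - s * (u x - up) - (velocity M (u x) (h x) - vp)) \<and>
           continuous_on UNIV h \<and>
           (\<exists>N. finite N \<and>
             (\<forall>x. x \<notin> N \<longrightarrow>
                h differentiable (at x) \<and>
                (accelerating M s u h x \<longrightarrow> (\<lambda>y. hA M (u y)) differentiable (at x)) \<and>
                (decelerating M s u h x \<longrightarrow> (\<lambda>y. hD M (u y)) differentiable (at x)) \<and>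
                s * deriv h x =
                  s * of_bool (accelerating M s u h x) * deriv (\<lambda>y. hA M (u y)) x +
                  s * of_bool (decelerating M s u h x) * deriv (\<lambda>y. hD M (u y)) x)) \<and>
           (u \<longlongrightarrow> um) at_bot \<and> (u \<longlongrightarrow> up) at_top \<and>
           (h \<longlongrightarrow> hm) at_bot \<and> (h \<longlongrightarrow> hp) at_top \<and>
           (deriv u \<longlongrightarrow> 0) at_bot \<and> (deriv u \<longlongrightarrow> 0) at_top \<and>
           (deriv h \<longlongrightarrow> 0) at_bot \<and> (deriv h \<longlongrightarrow> 0) at_top)"

end

theory Submission
  imports Defs
begin

text \<open>
  The chord condition forces the secant slope \<open>(v\<^sub>+ - v\<^sub>-) / (u\<^sub>+ - u\<^sub>-) = -s\<close> to be positive, because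
  \<open>v\<close> does not drop below \<open>v\<^sub>-\<close> on the scanning curve \<open>h = h\<^sub>-\<close>. With \<open>s < 0\<close> the
  hysteresis law lets \<open>h\<close> change along an increasing \<open>u\<close> only on the acceleration curve. So an
  increasing profile has one possible path: it follows the scanning curve \<open>h = h\<^sub>-\<close> up to \<open>u = u\<^sup>A(h\<^sub>-)\<close> and then
  the acceleration curve \<open>h = h\<^sup>A(u)\<close> up to \<open>u\<^sub>+\<close>.

  On this path \<open>v\<close> is a continuous function of \<open>u\<close> alone (\<open>path_velocity\<close>), and the system becomes
  one autonomous equation \<open>u' = rate u\<close>. The function \<open>rate\<close> vanishes at \<open>u\<^sub>-\<close> and \<open>u\<^sub>+\<close> by the
  choice of \<open>s\<close>, and the two parts of the chord condition say exactly that it is positive between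
  them (\<open>rate_pos\<close>). Such an equation is solved by inverting the travel time \<open>T\<close>, an antiderivative
  of \<open>1 / rate\<close> (\<open>heteroclinic_orbit\<close>), a method that suits a merely continuous \<open>rate\<close>: it
  may have a kink on arrival at the acceleration curve, and \<open>v\<^sup>S\<close> is only known to be continuous on
  the boundary of its domain, where \<open>u\<^sub>-\<close> may lie. The orbit exists for all times because \<open>rate\<close> vanishes at most linearly at the
  two ends, so that \<open>T\<close> is infinite there. At \<open>u\<^sub>-\<close> this holds because the velocity on the path is at
  least \<open>v\<^sub>-\<close>, at \<open>u\<^sub>+\<close> because \<open>v\<^sup>A\<close> is differentiable.

  The profile of \<open>h\<close> fails to be differentiable at two points at most: on arrival at the acceleration
  curve, and on passing \<open>u\<^sub>c\<close>, where \<open>h\<^sup>A\<close> may have a kink.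
\<close>

section \<open>Monotone heteroclinic orbits of a scalar equation\<close>

text \<open>Comparison of \<open>1 / g\<close> with \<open>1 / (C * (b - u))\<close>, whose integral diverges logarithmically at
  \<open>b\<close>.\<close>

lemma travel_time_unbounded:
  fixes T g :: "real \<Rightarrow> real"
  assumes "c < b" "0 < C"
    and T: "\<And>u. c \<le> u \<Longrightarrow> u < b \<Longrightarrow> (T has_real_derivative 1 / g u) (at u)"
    and g: "\<And>u. c \<le> u \<Longrightarrow> u < b \<Longrightarrow> 0 < g u \<and> g u \<le> C * (b - u)"
  shows "\<exists>u\<in>{c..<b}. y \<le> T u"
proof -
  \<comment> \<open>The point where the comparison bound \<open>T c + (ln (b - c) - ln (b - u)) / C\<close> equals
    \<open>T c + k / C\<close>, which is at least \<open>y\<close>; the maximum keeps it to the right of \<open>c\<close>.\<close>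
  define k where "k = max 0 (C * (y - T c))"
  define u where "u = b - (b - c) * exp (- k)"
  have "exp (- k) \<le> 1" by (simp add: k_def)
  then have "(b - c) * exp (- k) \<le> b - c"
    using \<open>c < b\<close> by (intro mult_left_le) auto
  then have u: "c \<le> u" "u < b"
    using \<open>c < b\<close> unfolding u_def by (linarith, simp)
  have "T c + ln (b - c) / C \<le> T u + ln (b - u) / C"
  proof (rule DERIV_nonneg_imp_nondecreasing[OF u(1)])
    fix x assume x: "c \<le> x" "x \<le> u"
    then have xb: "c \<le> x" "x < b" using u by auto
    have "((\<lambda>x. T x + ln (b - x) / C) has_real_derivative
        1 / g x + (- 1 / (b - x)) / C) (at x)"
      using xb \<open>0 < C\<close> by (auto intro!: derivative_eq_intros T)
    moreover have "1 / (C * (b - x)) \<le> 1 / g x"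
      using g[OF xb] xb \<open>0 < C\<close> by (intro divide_left_mono) auto
    ultimately show "\<exists>d. ((\<lambda>x. T x + ln (b - x) / C) has_real_derivative d) (at x) \<and> 0 \<le> d"
      by (intro exI conjI) (auto simp: field_simps)
  qed
  also have "ln (b - u) = ln (b - c) - k"
    using \<open>c < b\<close> by (simp add: u_def ln_mult)
  finally have "T c + k / C \<le> T u" by (simp add: field_simps diff_divide_distrib)
  moreover have "y - T c \<le> k / C"
    using \<open>0 < C\<close> by (simp add: k_def field_simps)
  ultimately show ?thesis using u by (intro bexI[of _ u]) auto
qed

text \<open>Separation of variables: an antiderivative \<open>T\<close> of \<open>1 / g\<close> is increasing and, by the linear bounds
  at the two ends, maps the interval onto the whole line. Its inverse is the orbit.\<close>

lemma heteroclinic_orbit: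
  fixes g :: "real \<Rightarrow> real"
  assumes cont: "continuous_on {a<..<b} g"
    and pos: "\<And>u. a < u \<Longrightarrow> u < b \<Longrightarrow> 0 < g u"
    and C: "a < c" "c < b" "0 < C"
    and left: "\<And>u. a < u \<Longrightarrow> u \<le> c \<Longrightarrow> g u \<le> C * (u - a)"
    and right: "\<And>u. c \<le> u \<Longrightarrow> u < b \<Longrightarrow> g u \<le> C * (b - u)"
  obtains u where "\<And>x. a < u x \<and> u x < b" "\<And>x. (u has_real_derivative g (u x)) (at x)"
    "strict_mono u" "(u \<longlongrightarrow> a) at_bot" "(u \<longlongrightarrow> b) at_top"
proof -
  have "a < b" using C by simp
  have "isCont (\<lambda>u. 1 / g u) x" if "a < x" "x < b" for x
    using cont that pos[OF that]
    by (auto intro!: continuous_intros simp: continuous_on_eq_continuous_at)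
  then obtain T where T: "\<And>x. a < x \<Longrightarrow> x < b \<Longrightarrow> (T has_real_derivative 1 / g x) (at x)"
    using einterval_antiderivative[of "ereal a" "ereal b" "\<lambda>u. 1 / g u"] \<open>a < b\<close>
    by (auto simp: has_real_derivative_iff_has_vector_derivative)
  have mono: "T x < T y" if "a < x" "x < y" "y < b" for x y
    using that by (intro DERIV_pos_imp_increasing[OF that(2)])
      (metis T divide_pos_pos le_less_trans less_le_trans pos zero_less_one)
  have le_iff: "T x \<le> T y \<longleftrightarrow> x \<le> y" if "a < x" "x < b" "a < y" "y < b" for x y
    using mono[of x y] mono[of y x] that by (cases x y rule: linorder_cases) auto
  have Tc: "isCont T x" if "a < x" "x < b" for x
    using T[OF that] by (rule DERIV_isCont)
  have above: "\<exists>u. a < u \<and> u < b \<and> y \<le> T u" for y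
  proof -
    have "\<exists>u\<in>{c..<b}. y \<le> T u"
      using C by (intro travel_time_unbounded[where C = C and g = g]) (auto intro!: T pos right)
    then show ?thesis using C by (meson atLeastLessThan_iff less_le_trans)
  qed
  have below: "\<exists>u. a < u \<and> u < b \<and> T u \<le> y" for y
  proof -
    \<comment> \<open>The reflection \<open>u \<mapsto> -u\<close> exchanges the two ends.\<close>
    have "\<exists>u\<in>{-c..<-a}. - y \<le> (\<lambda>u. - T (- u)) u"
    proof (rule travel_time_unbounded)
      fix u assume u: "- c \<le> u" "u < - a"
      have "((\<lambda>u. T (- u)) has_real_derivative (1 / g (- u)) * (- 1)) (at u)"
        using u C by (intro DERIV_chain'[where g = T]) (auto intro!: T derivative_eq_intros)
      from DERIV_minus[OF this]
      show "((\<lambda>u. - T (- u)) has_real_derivative 1 / g (- u)) (at u)" by simp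
      show "0 < g (- u) \<and> g (- u) \<le> C * (- a - u)"
        using u C pos[of "- u"] left[of "- u"] by (auto simp: algebra_simps)
    qed (use C in auto)
    then obtain u where "- c \<le> u" "u < - a" "- y \<le> - T (- u)" by auto
    then show ?thesis using C by (intro exI[of _ "- u"]) auto
  qed
  have surj: "\<exists>u. a < u \<and> u < b \<and> T u = y" for y
  proof -
    obtain p q where pq: "a < p" "p < b" "T p \<le> y" "a < q" "q < b" "y \<le> T q"
      using above below by meson
    then have "p \<le> q" using le_iff[of p q] by linarith
    then show ?thesis
      using IVT[of T p y q] pq Tc by (meson le_less_trans less_le_trans)
  qed
  then obtain u where u: "\<And>y. a < u y" "\<And>y. u y < b" "\<And>y. T (u y) = y" by metis
  have uT: "u (T x) = x" if "a < x" "x < b" for x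
    using le_iff[of "u (T x)" x] le_iff[of x "u (T x)"] u that by (simp add: order_antisym)
  have u_mono: "strict_mono u"
  proof (rule strict_monoI)
    fix x y :: real assume "x < y"
    then have "\<not> u y \<le> u x"
      using le_iff[of "u y" "u x"] u by simp
    then show "u x < u y" by simp
  qed
  have deriv: "(u has_real_derivative g (u x)) (at x)" for x
  proof -
    define l r where "l = (a + u x) / 2" and "r = (u x + b) / 2"
    have lr: "a < l" "l < u x" "u x < r" "r < b"
      using u(1)[of x] u(2)[of x] by (auto simp: l_def r_def)
    have "isCont u (T (u x))"
    proof (rule isCont_inverse_function2[OF lr(2,3)])
      fix z assume "l \<le> z" "z \<le> r"
      then have "a < z" "z < b" using lr by linarith+
      then show "u (T z) = z" "isCont T z" by (fact uT, fact Tc)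
    qed
    then have "isCont u x" by (simp add: u)
    then have "(u has_real_derivative inverse (1 / g (u x))) (at x)"
      using pos[OF u(1,2), of x]
      by (intro DERIV_inverse_function[where f = T and a = "x - 1" and b = "x + 1"] T)
        (simp_all add: u)
    then show ?thesis by simp
  qed
  have "(u \<longlongrightarrow> a) at_bot"
  proof (rule order_tendstoI)
    fix l assume "a < l"
    define p where "p = min l c"
    have "u y < l" if "y < T p" for y
      using strict_monoD[OF u_mono that] uT[of p] C \<open>a < l\<close> by (auto simp: p_def)
    then show "eventually (\<lambda>y. u y < l) at_bot"
      unfolding eventually_at_bot_dense by blast
  qed (auto intro!: always_eventually u less_trans[OF _ u(1)])
  moreover have "(u \<longlongrightarrow> b) at_top"
  proof (rule order_tendstoI)
    fix l assume "l < b"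
    define p where "p = max l c"
    have "l < u y" if "T p < y" for y
      using strict_monoD[OF u_mono that] uT[of p] C \<open>l < b\<close> by (auto simp: p_def)
    then show "eventually (\<lambda>y. l < u y) at_top"
      unfolding eventually_at_top_dense by blast
  qed (auto intro!: always_eventually u less_trans[OF u(2)])
  ultimately show thesis
    using that[of u] u deriv u_mono by blast
qed

section \<open>The acceleration, deceleration and scanning curves\<close>

lemma continuous_bij_increasing:
  fixes f :: "real \<Rightarrow> real"
  assumes bij: "bij_betw f {a..} {b..}" and cont: "continuous_on {a..} f"
  shows "strict_mono_on {a..} f"
proof -
  \<comment> \<open>A decreasing function would be bounded above by its value at \<open>a\<close>.\<close>
  have "\<not> monotone_on {a..} (<) (>) f"
  proof
    assume anti: "monotone_on {a..} (<) (>) f"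
    have "f a \<in> {b..}" using bij by (auto simp: bij_betw_def)
    then have "f a + 1 \<in> f ` {a..}" using bij by (auto simp: bij_betw_def)
    then obtain x where x: "a \<le> x" "f x = f a + 1" by auto
    then have "a < x" by (cases "x = a") auto
    then show False using monotone_onD[OF anti, of a x] x by auto
  qed
  then show ?thesis
    using injective_eq_monotone_map[of "{a..}" f] bij cont
    by (auto simp: bij_betw_def is_interval_ci)
qed

lemma C1_on_continuous_on: "C1_on I f \<Longrightarrow> continuous_on I f"
  unfolding C1_on_def continuous_on_eq_continuous_within
  by (auto intro: differentiable_imp_continuous_within)

lemma continuous_on_halfline_join:
  fixes f :: "real \<Rightarrow> real"
  assumes "continuous_on {a..c} f" "continuous_on {c..} f" "a \<le> c"
  shows "continuous_on {a..} f"
proof -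
  have "continuous_on ({a..c} \<union> {c..}) f"
    using assms by (intro continuous_on_closed_Un) auto
  moreover have "{a..c} \<union> {c..} = {a..}" using \<open>a \<le> c\<close> by auto
  ultimately show ?thesis by simp
qed

lemma deriv_on_has_derivative:
  assumes "f differentiable (at x within I)" "x \<in> interior I"
  shows "(f has_real_derivative deriv_on I f x) (at x)"
proof -
  have "(f has_vector_derivative deriv_on I f x) (at x within I)"
    using assms(1) by (simp add: deriv_on_def flip: vector_derivative_works)
  then show ?thesis
    using at_within_interior[OF assms(2)]
    by (simp add: has_real_derivative_iff_has_vector_derivative)
qed

locale hysteresis_model =
  fixes M :: traffic_model
  assumes model: "hysteresis_traffic_model M"
begin

lemma
  shows u0A_gt_1: "1 < u0A M" and u0A_le_uc: "u0A M \<le> uc M"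
    and vA_eq_vD: "vA M (uc M) = vD M (uc M)"
    and vA_smooth: "smooth_on {u0A M..} (vA M)"
  using model
  unfolding hysteresis_traffic_model_def acceleration_deceleration_curves_def
  by blast+

lemma
  shows uA_bij: "bij_betw (uA M) {1..} {u0A M..}" and uD_bij: "bij_betw (uD M) {1..} {1..}"
    and vS_uA: "1 \<le> h \<Longrightarrow> vS M (uA M h) h = vA M (uA M h)"
    and vS_uD: "1 \<le> h \<Longrightarrow> vS M (uD M h) h = vD M (uD M h)"
    and hA_C1: "C1_on {u0A M..uc M} (hA M)" "C1_on {uc M..} (hA M)"
    and hD_C1: "C1_on {1..uc M} (hD M)" "C1_on {uc M..} (hD M)"
    and vS_continuous: "continuous_on (Omega M) (\<lambda>(u, h). vS M u h)"
    and vS_smooth: "smooth2_on (interior (Omega M)) (vS M)"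
  using model
  unfolding hysteresis_traffic_model_def scanning_curves_def
  by blast+

lemma
  shows vA_deriv_pos: "u0A M \<le> u \<Longrightarrow> 0 < deriv_on {u0A M..} (vA M) u"
    and vS_u_pos: "(u, h) \<in> interior (Omega M) \<Longrightarrow> 0 < partial_u (vS M) u h"
    and uD_le_uA: "1 \<le> h \<Longrightarrow> uD M h \<le> uA M h"
    and uA_eq_uD: "1 \<le> h \<Longrightarrow> uA M h = uD M h \<longleftrightarrow> h = hc M"
  using model
  unfolding hysteresis_traffic_model_def standing_assumption_def
  by blast+

lemma hA_uA: "1 \<le> h \<Longrightarrow> hA M (uA M h) = h"
  unfolding hA_def by (rule bij_betw_inv_into_left[OF uA_bij]) simp

lemma hD_uD: "1 \<le> h \<Longrightarrow> hD M (uD M h) = h"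
  unfolding hD_def by (rule bij_betw_inv_into_left[OF uD_bij]) simp

lemma uA_hA: "u0A M \<le> u \<Longrightarrow> uA M (hA M u) = u"
  unfolding hA_def by (rule bij_betw_inv_into_right[OF uA_bij]) simp

lemma uA_ge: "1 \<le> h \<Longrightarrow> u0A M \<le> uA M h"
  using bij_betwE[OF uA_bij] by simp

lemma uD_ge: "1 \<le> h \<Longrightarrow> 1 \<le> uD M h"
  using bij_betwE[OF uD_bij] by simp

lemma hA_continuous: "continuous_on {u0A M..} (hA M)"
  using hA_C1[THEN C1_on_continuous_on] u0A_le_uc by (rule continuous_on_halfline_join)

lemma hD_continuous: "continuous_on {1..} (hD M)"
  using hD_C1[THEN C1_on_continuous_on] less_imp_le[OF less_le_trans[OF u0A_gt_1 u0A_le_uc]]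
  by (rule continuous_on_halfline_join)

lemma hA_strict_mono: "strict_mono_on {u0A M..} (hA M)"
  using bij_betw_inv_into[OF uA_bij] hA_continuous
  unfolding hA_def by (rule continuous_bij_increasing)

lemma hD_strict_mono: "strict_mono_on {1..} (hD M)"
  using bij_betw_inv_into[OF uD_bij] hD_continuous
  unfolding hD_def by (rule continuous_bij_increasing)

lemma hA_ge_1: "u0A M \<le> u \<Longrightarrow> 1 \<le> hA M u"
  using bij_betwE[OF bij_betw_inv_into[OF uA_bij]] by (simp add: hA_def)

lemma hA_less_iff: "u0A M \<le> u \<Longrightarrow> u0A M \<le> w \<Longrightarrow> hA M u < hA M w \<longleftrightarrow> u < w"
  using strict_mono_on_less[OF hA_strict_mono] by simp

lemma hD_less_iff: "1 \<le> u \<Longrightarrow> 1 \<le> w \<Longrightarrow> hD M u < hD M w \<longleftrightarrow> u < w"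
  using strict_mono_on_less[OF hD_strict_mono] by simp

lemma uA_strict_mono: "1 \<le> h \<Longrightarrow> h < k \<Longrightarrow> uA M h < uA M k"
  using hA_less_iff[of "uA M h" "uA M k"] uA_ge hA_uA by simp

text \<open>The deceleration branch of the velocity takes precedence only at the crossing point
  \<open>u\<^sub>c\<close>, where the two curves have the same speed.\<close>

lemma velocity_uA:
  assumes "1 \<le> h"
  shows "velocity M (uA M h) h = vA M (uA M h)"
proof (cases "uA M h \<le> uD M h")
  case True
  then have "h = hc M" using uD_le_uA uA_eq_uD assms by force
  then have "uA M h = uc M" using uA_hA u0A_le_uc by (simp add: hc_def)
  then show ?thesis using True vA_eq_vD by (simp add: velocity_def)
qed (simp add: velocity_def)

lemma velocity_scanning:
  assumes "1 \<le> h" "uD M h < uA M h" "uD M h \<le> u" "u \<le> uA M h"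
  shows "velocity M u h = vS M u h"
  using assms vS_uA vS_uD by (auto simp: velocity_def)

lemma vS_continuous_u:
  assumes "1 \<le> h"
  shows "continuous_on {uD M h..uA M h} (\<lambda>u. vS M u h)"
proof -
  have "continuous_on {uD M h..uA M h} ((\<lambda>(u, h). vS M u h) \<circ> (\<lambda>u. (u, h)))"
    using uD_ge[OF assms] assms
    by (intro continuous_on_compose continuous_on_subset[OF vS_continuous] continuous_intros)
      (auto simp: Omega_def)
  then show ?thesis by (simp add: o_def)
qed

text \<open>Since \<open>h\<^sup>A\<close> and \<open>h\<^sup>D\<close> are increasing, the strip \<open>u\<^sup>D(h) < u < u\<^sup>A(h)\<close> is \<open>h\<^sup>A(u) < h < h\<^sup>D(u)\<close>; in this
  form it is open by the continuity of \<open>h\<^sup>A\<close> and \<open>h\<^sup>D\<close>. The maxima extend these functions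
  continuously to the whole line.\<close>

lemma interior_Omega:
  assumes "1 < u" "1 < h" "hA M (max (u0A M) u) < h" "h < hD M (max 1 u)"
  shows "(u, h) \<in> interior (Omega M)"
proof -
  let ?W = "{p. 1 < fst p \<and> 1 < snd p \<and> hA M (max (u0A M) (fst p)) < snd p \<and>
    snd p < hD M (max 1 (fst p))}"
  have "continuous_on UNIV (\<lambda>p::real \<times> real. hA M (max (u0A M) (fst p)))"
    by (rule continuous_on_compose2[OF hA_continuous]) (auto intro!: continuous_intros)
  moreover have "continuous_on UNIV (\<lambda>p::real \<times> real. hD M (max 1 (fst p)))"
    by (rule continuous_on_compose2[OF hD_continuous]) (auto intro!: continuous_intros)
  ultimately have "open ?W"
    by (auto intro!: open_Collect_conj open_Collect_less continuous_intros)
  moreover have "?W \<subseteq> Omega M"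
  proof
    fix p assume "p \<in> ?W"
    moreover obtain v k where p: "p = (v, k)" by (cases p)
    ultimately have *: "1 < v" "1 < k" "hA M (max (u0A M) v) < k" "k < hD M (max 1 v)"
      by auto
    have "max (u0A M) v < uA M k"
      using * hA_less_iff[of "max (u0A M) v" "uA M k"] hA_uA uA_ge by simp
    moreover have "uD M k < v"
      using * hD_less_iff[of "uD M k" v] hD_uD uD_ge by simp
    ultimately show "p \<in> Omega M" using * by (simp add: Omega_def p)
  qed
  ultimately show ?thesis using assms by (auto intro: interiorI)
qed

lemma vS_has_derivative:
  assumes "(u, h) \<in> interior (Omega M)"
  shows "((\<lambda>x. vS M x h) has_real_derivative partial_u (vS M) u h) (at u)"
proof -
  have "(\<lambda>(u, h). foldr (\<lambda>d G. d G) [] (vS M) u h) differentiable_on interior (Omega M)"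
    using vS_smooth unfolding smooth2_on_def by (metis empty_set empty_subsetI)
  then have "(\<lambda>(u, h). vS M u h) differentiable_on interior (Omega M)" by simp
  then have "(\<lambda>(u, h). vS M u h) differentiable (at (u, h))"
    using assms differentiable_on_eq_differentiable_at[OF open_interior] by blast
  then have "((\<lambda>(u, h). vS M u h) \<circ> (\<lambda>x. (x, h))) differentiable (at u)"
    by (intro differentiable_chain_at) (auto intro!: derivative_intros simp: differentiable_Pair)
  then have "(\<lambda>x. vS M x h) field_differentiable (at u)"
    by (simp add: o_def real_differentiable_def field_differentiable_def)
  then show ?thesis
    unfolding partial_u_def by (rule field_differentiable_derivI)
qed

text \<open>At \<open>h = 1\<close>, on the edge of the domain, the sign of the \<open>u\<close>-derivative is not available. Scanning
  curves with slightly larger \<open>h\<close> run in the interior over the same \<open>u\<close>-interval and are increasing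
  there, and continuity of \<open>v\<^sup>S\<close> carries weak monotonicity over to the limit. The same
  argument serves every \<open>h\<close>.\<close>

lemma vS_mono_open:
  assumes h: "1 \<le> h" and u: "uD M h < u" "u \<le> w" "w < uA M h"
  shows "vS M u h \<le> vS M w h"
proof -
  have u1: "1 < u" using uD_ge[OF h] u by simp
  define d where "d = (h + hD M u) / 2"
  have "h < hD M u" using hD_less_iff[of "uD M h" u] uD_ge h hD_uD u u1 by simp
  then have d: "h < d" "d < hD M u" by (auto simp: d_def)
  have inside: "(x, k) \<in> interior (Omega M)" if "h < k" "k \<le> d" "u \<le> x" "x \<le> w" for x k
  proof (rule interior_Omega)
    have "hA M (max (u0A M) x) \<le> hA M (uA M h)"
      using strict_mono_on_leD[OF hA_strict_mono] that u uA_ge[OF h] by auto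
    then show "hA M (max (u0A M) x) < k" using hA_uA[OF h] that by simp
    have "hD M u \<le> hD M x"
      using strict_mono_on_leD[OF hD_strict_mono] that u1 by auto
    then show "k < hD M (max 1 x)" using that u1 d by (simp add: max_def)
  qed (use that u1 h in auto)
  have "vS M u k \<le> vS M w k" if "h < k" "k \<le> d" for k
  proof (rule DERIV_nonneg_imp_nondecreasing[OF u(2)])
    fix x assume "u \<le> x" "x \<le> w"
    then have "(x, k) \<in> interior (Omega M)" using inside that by simp
    then show "\<exists>y. ((\<lambda>x. vS M x k) has_real_derivative y) (at x) \<and> 0 \<le> y"
      using vS_has_derivative vS_u_pos less_imp_le by blast
  qed
  then have le: "0 \<le> vS M w k - vS M u k" if "k \<in> {h<..<d}" for k using that by simp
  have cont: "continuous_on {h..d} (\<lambda>k. vS M x k)" if "u \<le> x" "x \<le> w" for x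
  proof -
    have "(x, k) \<in> Omega M" if "k \<in> {h..d}" for k
    proof (cases "k = h")
      case True
      then show ?thesis using u1 h u \<open>u \<le> x\<close> \<open>x \<le> w\<close> by (auto simp: Omega_def)
    next
      case False
      then show ?thesis using inside[of k x] that \<open>u \<le> x\<close> \<open>x \<le> w\<close> interior_subset by fastforce
    qed
    then have "continuous_on {h..d} ((\<lambda>(u, h). vS M u h) \<circ> (\<lambda>k. (x, k)))"
      by (intro continuous_on_compose continuous_on_subset[OF vS_continuous] continuous_intros) auto
    then show ?thesis by (simp add: o_def)
  qed
  have "continuous_on (closure {h<..<d}) (\<lambda>k. vS M w k - vS M u k)"
    using d u by (auto intro!: continuous_intros cont)
  from continuous_ge_on_closure[OF this _ le, of h] d show ?thesis by simp
qed

lemma vS_mono: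
  assumes h: "1 \<le> h" and u: "uD M h \<le> u" "u \<le> w" "w \<le> uA M h"
  shows "vS M u h \<le> vS M w h"
proof -
  note cont = continuous_on_subset[OF vS_continuous_u[OF h]]
  have upto: "vS M u h \<le> vS M w h" if u: "uD M h < u" "u < w" "w \<le> uA M h" for u w
  proof -
    have "continuous_on (closure {u<..<w}) (\<lambda>w. vS M w h)"
      using u by (intro cont) auto
    from continuous_ge_on_closure[OF this, of w "vS M u h"] vS_mono_open[OF h] u
    show ?thesis by auto
  qed
  show ?thesis
  proof (cases "u = w")
    case False
    have "continuous_on (closure {u<..<w}) (\<lambda>w. vS M w h)"
      using u False by (intro cont) auto
    from continuous_le_on_closure[OF this, of u "vS M w h"] upto u False
    show ?thesis by auto
  qed simp
qed

lemma vA_has_derivative: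
  assumes "u0A M < u"
  shows "(vA M has_real_derivative deriv_on {u0A M..} (vA M) u) (at u)"
proof (rule deriv_on_has_derivative)
  have "((deriv_on {u0A M..} ^^ 0) (vA M)) differentiable (at u within {u0A M..})"
    using vA_smooth assms unfolding smooth_on_def by (meson atLeast_iff less_imp_le)
  then show "vA M differentiable (at u within {u0A M..})" by simp
qed (use assms in simp)

lemma vA_continuous: "continuous_on {u0A M..} (vA M)"
proof -
  have "((deriv_on {u0A M..} ^^ 0) (vA M)) differentiable (at u within {u0A M..})"
    if "u \<in> {u0A M..}" for u
    using vA_smooth that unfolding smooth_on_def by blast
  then show ?thesis
    by (auto simp: continuous_on_eq_continuous_within intro: differentiable_imp_continuous_within)
qed

lemma vA_mono:
  assumes "u0A M \<le> u" "u \<le> w"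
  shows "vA M u \<le> vA M w"
proof (cases "u = w")
  case False
  have "vA M u < vA M w"
  proof (rule DERIV_pos_imp_increasing_open[where f = "vA M"])
    show "continuous_on {u..w} (vA M)"
      using assms by (intro continuous_on_subset[OF vA_continuous]) auto
    fix x assume "u < x" "x < w"
    then show "\<exists>y. (vA M has_real_derivative y) (at x) \<and> 0 < y"
      using vA_has_derivative[of x] vA_deriv_pos[of x] assms by auto
  qed (use assms False in auto)
  then show ?thesis by simp
qed simp

text \<open>Away from \<open>u\<^sub>c\<close> the one-sided smoothness of the two zones gives an ordinary derivative.\<close>

lemma hA_has_derivative:
  assumes "u0A M < u" "u \<noteq> uc M"
  shows "(hA M has_real_derivative
      (if u < uc M then deriv_on {u0A M..uc M} (hA M) u else deriv_on {uc M..} (hA M) u)) (at u)"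
  using hA_C1 assms unfolding C1_on_def
  by (auto intro!: deriv_on_has_derivative)

end

section \<open>The profile\<close>

locale accelerating_shock = hysteresis_model +
  fixes um hm up hp :: real
  assumes start_Omega: "(um, hm) \<in> Omega M"
    and up_uA: "up = uA M hp"
    and hm_less_hp: "hm < hp"
    and um_less_uA: "um < uA M hm"
    and chord_scanning: "\<And>u. um < u \<Longrightarrow> u < up \<Longrightarrow>
      (velocity M u hm - velocity M um hm) / (u - um)
        < (velocity M up hp - velocity M um hm) / (up - um)"
    and chord_acceleration: "\<And>u. um < u \<Longrightarrow> u < up \<Longrightarrow> u0A M \<le> u \<Longrightarrow>
      (vA M u - velocity M um hm) / (u - um)
        < (velocity M up hp - velocity M um hm) / (up - um)"
begin

text \<open>This is \<open>-s\<close>.\<close>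

definition slope :: real where
  "slope = (velocity M up hp - velocity M um hm) / (up - um)"

definition path_velocity :: "real \<Rightarrow> real" where
  "path_velocity u = (if u \<le> uA M hm then vS M u hm else vA M u)"

definition rate :: "real \<Rightarrow> real" where
  "rate u = slope * (u - um) - (path_velocity u - velocity M um hm)"

text \<open>The maximum encodes both phases: up to the arrival at the acceleration curve the value is
  \<open>h\<^sup>A(u\<^sup>A(h\<^sub>-)) = h\<^sub>-\<close>.\<close>

definition path_h :: "real \<Rightarrow> real" where
  "path_h u = hA M (max (uA M hm) u)"

lemma
  shows hm_ge_1: "1 \<le> hm" and um_ge_1: "1 \<le> um" and uD_le_um: "uD M hm \<le> um"
  using start_Omega by (auto simp: Omega_def)

lemma kink_less_up: "uA M hm < up"
  using uA_strict_mono[OF hm_ge_1 hm_less_hp] up_uA by simp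

lemma um_less_up: "um < up"
  using um_less_uA kink_less_up by simp

lemma kink_ge_u0A: "u0A M \<le> uA M hm"
  using uA_ge hm_ge_1 .

lemma velocity_start: "velocity M um hm = vS M um hm"
  using velocity_scanning[OF hm_ge_1] uD_le_um um_less_uA by simp

lemma velocity_end: "velocity M up hp = vA M up"
  using velocity_uA[of hp] hm_ge_1 hm_less_hp up_uA by simp

lemma path_h_scanning: "u \<le> uA M hm \<Longrightarrow> path_h u = hm"
  using hA_uA hm_ge_1 by (simp add: path_h_def max_def)

lemma path_h_acceleration: "uA M hm \<le> u \<Longrightarrow> path_h u = hA M u"
  by (simp add: path_h_def max_def)

lemma path_h_continuous: "continuous_on UNIV path_h"
  unfolding path_h_def using kink_ge_u0A
  by (intro continuous_on_compose2[OF hA_continuous]) (auto intro!: continuous_intros)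

lemma path_in_Omega:
  assumes "um \<le> u"
  shows "(u, path_h u) \<in> Omega M"
proof (cases "u \<le> uA M hm")
  case True
  then show ?thesis
    using path_h_scanning um_ge_1 hm_ge_1 uD_le_um assms by (simp add: Omega_def)
next
  case False
  then have "u0A M \<le> u" using kink_ge_u0A by simp
  then show ?thesis
    using False path_h_acceleration[of u] hA_ge_1[of u] uA_hA[of u] uD_le_uA[of "hA M u"]
      um_ge_1 assms
    by (simp add: Omega_def)
qed

lemma path_velocity_eq:
  assumes "um \<le> u"
  shows "velocity M u (path_h u) = path_velocity u"
proof (cases "u \<le> uA M hm")
  case True
  then show ?thesis
    using velocity_scanning[OF hm_ge_1, of u] path_h_scanning[of u] uD_le_um um_less_uA assms
    by (simp add: path_velocity_def)
next
  case False
  then have "u0A M \<le> u" using kink_ge_u0A by simp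
  then show ?thesis
    using False path_h_acceleration[of u] velocity_uA[of "hA M u"] hA_ge_1[of u] uA_hA[of u]
    by (simp add: path_velocity_def)
qed

lemma path_velocity_continuous: "continuous_on {um..} path_velocity"
  unfolding path_velocity_def
proof (rule continuous_on_cases_le)
  show "continuous_on {u \<in> {um..}. u \<le> uA M hm} (\<lambda>u. vS M u hm)"
    using uD_le_um by (intro continuous_on_subset[OF vS_continuous_u[OF hm_ge_1]]) auto
  show "continuous_on {u \<in> {um..}. uA M hm \<le> u} (vA M)"
    using kink_ge_u0A by (intro continuous_on_subset[OF vA_continuous]) auto
qed (use vS_uA hm_ge_1 in \<open>auto intro!: continuous_intros\<close>)

lemma rate_continuous: "continuous_on {um..} rate"
  unfolding rate_def by (intro continuous_intros path_velocity_continuous)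

text \<open>Speed does not decrease along the scanning curve, nor along the acceleration curve after it.\<close>

lemma path_velocity_ge:
  assumes "um \<le> u"
  shows "velocity M um hm \<le> path_velocity u"
proof (cases "u \<le> uA M hm")
  case True
  then show ?thesis
    using vS_mono[OF hm_ge_1, of um u] uD_le_um assms
    by (simp add: path_velocity_def velocity_start)
next
  case False
  have "vS M um hm \<le> vS M (uA M hm) hm"
    using vS_mono[OF hm_ge_1] uD_le_um um_less_uA by simp
  also have "\<dots> = vA M (uA M hm)" using vS_uA hm_ge_1 .
  also have "\<dots> \<le> vA M u" using vA_mono kink_ge_u0A False by simp
  finally show ?thesis using False by (simp add: path_velocity_def velocity_start)
qed

lemma rate_start: "rate um = 0"
  using um_less_uA by (simp add: rate_def path_velocity_def velocity_start)

lemma slope_mult: "slope * (up - um) = velocity M up hp - velocity M um hm"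
  using um_less_up by (simp add: slope_def)

lemma rate_from_end: "rate u = slope * (u - up) - (path_velocity u - velocity M up hp)"
  using slope_mult by (simp add: rate_def algebra_simps)

lemma rate_end: "rate up = 0"
  using kink_less_up by (simp add: rate_from_end path_velocity_def velocity_end)

text \<open>The chord condition for \<open>v(u, h\<^sub>-)\<close> covers the scanning phase, the one for \<open>v\<^sup>A\<close> the
  acceleration phase.\<close>

lemma rate_pos:
  assumes u: "um < u" "u < up"
  shows "0 < rate u"
proof -
  have "(path_velocity u - velocity M um hm) / (u - um) < slope"
  proof (cases "u \<le> uA M hm")
    case True
    then have "velocity M u hm = path_velocity u"
      using path_velocity_eq[of u] path_h_scanning[of u] u by simp
    then show ?thesis using chord_scanning[OF u] by (simp add: slope_def)
  next
    case False
    then show ?thesis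
      using chord_acceleration[OF u] kink_ge_u0A by (simp add: slope_def path_velocity_def)
  qed
  then show ?thesis using u by (simp add: rate_def divide_less_eq)
qed

text \<open>At the arrival point on the acceleration curve \<open>rate\<close> is positive although the speed is at
  least \<open>v\<^sub>-\<close> there, so the linear term of \<open>rate\<close> must be positive.\<close>

lemma slope_pos: "0 < slope"
proof -
  have "0 < rate (uA M hm)" using rate_pos um_less_uA kink_less_up .
  moreover have "velocity M um hm \<le> path_velocity (uA M hm)"
    using path_velocity_ge um_less_uA by simp
  ultimately have "0 < slope * (uA M hm - um)" by (simp add: rate_def)
  then show ?thesis using um_less_uA by (simp add: zero_less_mult_iff)
qed

lemma rate_le_linear_start: "um \<le> u \<Longrightarrow> rate u \<le> slope * (u - um)"
  using path_velocity_ge by (simp add: rate_def)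

text \<open>Near \<open>u\<^sub>+\<close> the path lies on the acceleration curve, so \<open>rate\<close> is at most \<open>v\<^sup>A(u\<^sub>+) - v\<^sup>A(u)\<close>, and
  differentiability at \<open>u\<^sub>+\<close> bounds this difference linearly.\<close>

lemma rate_le_linear_end:
  obtains c C where "um < c" "c < up" "0 < C"
    "\<And>u. c \<le> u \<Longrightarrow> u < up \<Longrightarrow> rate u \<le> C * (up - u)"
proof -
  define D where "D = deriv_on {u0A M..} (vA M) up"
  have "u0A M < up" using kink_ge_u0A kink_less_up by simp
  then have D: "(vA M has_real_derivative D) (at up)" and "0 < D"
    unfolding D_def by (auto intro: vA_has_derivative vA_deriv_pos)
  then have "eventually (\<lambda>u. (vA M u - vA M up) / (u - up) < D + 1) (at up)"
    using order_tendstoD(2)[of _ D "at up" "D + 1"] by (simp add: has_field_derivative_iff)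
  then have "eventually (\<lambda>u. (vA M u - vA M up) / (u - up) < D + 1) (at_left up)"
    by (rule filter_leD[OF at_le, rotated]) simp
  then obtain d where d: "d < up"
    "\<And>u. d < u \<Longrightarrow> u < up \<Longrightarrow> (vA M u - vA M up) / (u - up) < D + 1"
    unfolding eventually_at_left_field by blast
  define c where "c = (max d (uA M hm) + up) / 2"
  have c: "max d (uA M hm) < c" "c < up" using d kink_less_up by (auto simp: c_def)
  show thesis
  proof (rule that[of c "D + 1"])
    fix u assume u: "c \<le> u" "u < up"
    then have "vA M up - vA M u \<le> (D + 1) * (up - u)"
      using d(2)[of u] c by (simp add: neg_divide_less_eq algebra_simps)
    moreover have "rate u \<le> vA M up - vA M u"
      using u c slope_pos
      by (simp add: rate_from_end path_velocity_def velocity_end mult_pos_neg less_imp_le)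
    ultimately show "rate u \<le> (D + 1) * (up - u)" by simp
  qed (use c um_less_uA \<open>0 < D\<close> in auto)
qed

lemma profile_exists:
  obtains u where "\<And>x. um < u x \<and> u x < up" "\<And>x. (u has_real_derivative rate (u x)) (at x)"
    "strict_mono u" "(u \<longlongrightarrow> um) at_bot" "(u \<longlongrightarrow> up) at_top"
proof -
  obtain c C where c: "um < c" "c < up" "0 < C"
    and C: "\<And>u. c \<le> u \<Longrightarrow> u < up \<Longrightarrow> rate u \<le> C * (up - u)"
    using rate_le_linear_end by blast
  show thesis
  proof (rule heteroclinic_orbit[of um up rate c "max C slope"])
    show "continuous_on {um<..<up} rate"
      by (rule continuous_on_subset[OF rate_continuous]) auto
    fix u
    show "rate u \<le> max C slope * (u - um)" if "um < u"
      using rate_le_linear_start[of u] mult_right_mono[OF max.cobounded2[of slope C], of "u - um"]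
        that by linarith
    show "rate u \<le> max C slope * (up - u)" if "c \<le> u" "u < up"
      using C[OF that] mult_right_mono[OF max.cobounded1[of C slope], of "up - u"] that
      by linarith
  qed (use c um_less_up rate_pos that in auto)
qed

lemma rate_tendsto:
  assumes "(u \<longlongrightarrow> l) F" "um \<le> l" "eventually (\<lambda>x. um \<le> u x) F"
  shows "((\<lambda>x. rate (u x)) \<longlongrightarrow> rate l) F"
  using rate_continuous assms by (auto intro: continuous_on_tendsto_compose)

lemma accelerating_wave_exists: "\<exists>u h. traveling_wave M (um, hm) (up, hp) u h"
proof -
  obtain u where u: "\<And>x. um < u x" "\<And>x. u x < up"
    and u_deriv: "\<And>x. (u has_real_derivative rate (u x)) (at x)"
    and u_mono: "strict_mono u"
    and u_bot: "(u \<longlongrightarrow> um) at_bot" and u_top: "(u \<longlongrightarrow> up) at_top"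
    using profile_exists by metis
  define h where "h x = path_h (u x)" for x
  \<comment> \<open>Arrival at the acceleration curve and passage through the possible kink of \<open>hA\<close>.\<close>
  define N where "N = u -` {uA M hm, uc M}"
  have "finite N"
    unfolding N_def using strict_mono_imp_inj_on[OF u_mono]
    by (intro finite_vimageI) (auto intro: inj_on_subset)
  have du: "deriv u x = rate (u x)" for x
    using u_deriv by (rule DERIV_imp_deriv)
  have du_pos: "0 < deriv u x" for x
    using rate_pos u by (simp add: du)
  have u_cont: "continuous_on UNIV u"
    using u_deriv DERIV_isCont continuous_at_imp_continuous_on by blast
  have h_cont: "continuous_on UNIV h"
    unfolding h_def by (rule continuous_on_compose2[OF path_h_continuous u_cont]) simp
  have near: "eventually (\<lambda>y. u y \<in> S) (nhds x)" if "open S" "u x \<in> S" for x S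
    using u_deriv[of x, THEN DERIV_isCont] that
    by (simp add: isCont_def tendsto_at_iff_tendsto_nhds topological_tendstoD)
  have h_before: "(h has_real_derivative 0) (at x)" if "u x < uA M hm" for x
  proof -
    have "eventually (\<lambda>y. h y = hm) (nhds x)"
      using near[of "{..<uA M hm}" x] that
      by (auto elim!: eventually_mono simp: h_def path_h_scanning)
    then show ?thesis by (subst DERIV_cong_ev[OF refl _ refl]) auto
  qed
  have hA_u: "((\<lambda>y. hA M (u y)) has_real_derivative
      (if u x < uc M then deriv_on {u0A M..uc M} (hA M) (u x)
       else deriv_on {uc M..} (hA M) (u x)) * rate (u x)) (at x)"
    if "uA M hm < u x" "u x \<noteq> uc M" for x
    using DERIV_chain2[OF hA_has_derivative u_deriv, of x] that kink_ge_u0A by simp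
  have h_after: "(h has_real_derivative deriv (\<lambda>y. hA M (u y)) x) (at x)"
    if "uA M hm < u x" "u x \<noteq> uc M" for x
  proof -
    have "eventually (\<lambda>y. h y = hA M (u y)) (nhds x)"
      using near[of "{uA M hm<..}" x] that
      by (auto elim!: eventually_mono simp: h_def path_h_acceleration)
    moreover have "((\<lambda>y. hA M (u y)) has_real_derivative deriv (\<lambda>y. hA M (u y)) x) (at x)"
      using hA_u[OF that] DERIV_imp_deriv by force
    ultimately show ?thesis by (subst DERIV_cong_ev[OF refl _ refl])
  qed
  have speed: "wave_speed M (um, hm) (up, hp) = - slope"
    unfolding wave_speed_def slope_def prod.case by (rule minus_divide_left[symmetric])
  have acc: "accelerating M (- slope) u h x \<longleftrightarrow> uA M hm \<le> u x" for x
  proof -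
    have "u x = uA M (h x) \<longleftrightarrow> uA M hm \<le> u x"
    proof (cases "u x \<le> uA M hm")
      case True
      then show ?thesis by (auto simp: h_def path_h_scanning)
    next
      case False
      then show ?thesis
        using uA_hA kink_ge_u0A by (simp add: h_def path_h_acceleration)
    qed
    then show ?thesis
      using mult_pos_pos[OF slope_pos du_pos] by (simp add: accelerating_def)
  qed
  \<comment> \<open>Both factors of \<open>s * u'\<close> have a fixed sign, so the deceleration rule never applies.\<close>
  have dec: "\<not> decelerating M (- slope) u h x" for x
    using mult_pos_pos[OF slope_pos du_pos[of x]] by (simp add: decelerating_def)
  have h_eq: "h differentiable (at x) \<and>
      (accelerating M (- slope) u h x \<longrightarrow> (\<lambda>y. hA M (u y)) differentiable (at x)) \<and>
      deriv h x = of_bool (accelerating M (- slope) u h x) * deriv (\<lambda>y. hA M (u y)) x"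
    if "x \<notin> N" for x
  proof (cases "u x < uA M hm")
    case True
    then show ?thesis
      using h_before[OF True] by (auto simp: acc real_differentiable_def DERIV_imp_deriv)
  next
    case False
    with that have x: "uA M hm < u x" "u x \<noteq> uc M" by (auto simp: N_def)
    then show ?thesis
      using h_after[OF x] hA_u[OF x] acc[of x]
      by (auto simp: real_differentiable_def DERIV_imp_deriv)
  qed
  have ev_um: "eventually (\<lambda>x. um \<le> u x) F" for F
    using u less_imp_le by (intro always_eventually) blast
  have du_bot: "(deriv u \<longlongrightarrow> 0) at_bot" and du_top: "(deriv u \<longlongrightarrow> 0) at_top"
    using rate_tendsto[OF u_bot _ ev_um] rate_tendsto[OF u_top _ ev_um] um_less_up
    by (simp_all add: du[abs_def] rate_start rate_end)
  have before_ev: "eventually (\<lambda>x. u x < uA M hm) at_bot"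
    using order_tendstoD(2)[OF u_bot um_less_uA] .
  have h_bot: "(h \<longlongrightarrow> hm) at_bot"
    by (rule tendsto_eventually)
      (auto intro: eventually_mono[OF before_ev] simp: h_def path_h_scanning)
  have dh_bot: "(deriv h \<longlongrightarrow> 0) at_bot"
    by (rule tendsto_eventually)
      (auto intro: eventually_mono[OF before_ev] DERIV_imp_deriv h_before)
  have "path_h up = hp"
    using kink_less_up path_h_acceleration[of up] hA_uA[of hp] hm_ge_1 hm_less_hp up_uA by simp
  then have h_top: "(h \<longlongrightarrow> hp) at_top"
    using continuous_on_tendsto_compose[OF path_h_continuous u_top] by (simp add: h_def[abs_def])
  have after_ev: "eventually (\<lambda>x. uA M hm < u x) at_top"
    using order_tendstoD(1)[OF u_top kink_less_up] .
  have dh_top: "(deriv h \<longlongrightarrow> 0) at_top"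
  proof -
    \<comment> \<open>If \<open>up = uc\<close>, the profile approaches from below, so the congested zone counts.\<close>
    define I where "I = (if up \<le> uc M then {u0A M..uc M} else {uc M..})"
    have cont: "continuous_on I (deriv_on I (hA M))"
      using hA_C1 by (simp add: I_def C1_on_def)
    have "up \<in> I" using kink_ge_u0A kink_less_up by (auto simp: I_def)
    have zone: "eventually (\<lambda>x. up \<le> uc M \<or> uc M < u x) at_top"
      using order_tendstoD(1)[OF u_top, of "uc M"]
      by (cases "up \<le> uc M") (auto elim: eventually_mono)
    have ev: "eventually (\<lambda>x. u x \<in> I \<and> deriv_on I (hA M) (u x) * rate (u x) = deriv h x) at_top"
      using after_ev zone
    proof eventually_elim
      case (elim x)
      then have x: "uA M hm < u x" "u x \<noteq> uc M" "u x < uc M \<longleftrightarrow> up \<le> uc M"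
        using u(2)[of x] by auto
      have "deriv h x = deriv_on I (hA M) (u x) * rate (u x)"
        using DERIV_imp_deriv[OF h_after[OF x(1,2)]] DERIV_imp_deriv[OF hA_u[OF x(1,2)]] x(3)
        by (simp add: I_def)
      moreover have "u x \<in> I" using x kink_ge_u0A by (auto simp: I_def)
      ultimately show ?case by simp
    qed
    have "((\<lambda>x. deriv_on I (hA M) (u x)) \<longlongrightarrow> deriv_on I (hA M) up) at_top"
      using ev by (intro continuous_on_tendsto_compose[OF cont u_top \<open>up \<in> I\<close>])
        (auto elim: eventually_mono)
    moreover have "((\<lambda>x. rate (u x)) \<longlongrightarrow> 0) at_top"
      using du_top by (simp add: du[abs_def])
    ultimately have "((\<lambda>x. deriv_on I (hA M) (u x) * rate (u x)) \<longlongrightarrow> 0) at_top"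
      using tendsto_mult by fastforce
    then show ?thesis
      by (rule Lim_transform_eventually) (use ev in \<open>auto elim: eventually_mono\<close>)
  qed
  have u_diff: "u differentiable (at x)" for x
    using u_deriv by (auto simp: real_differentiable_def)
  have u_eq: "deriv u x = - (- slope) * (u x - um) - (velocity M (u x) (h x) - velocity M um hm)"
    "deriv u x = - (- slope) * (u x - up) - (velocity M (u x) (h x) - velocity M up hp)" for x
    using path_velocity_eq[of "u x"] u(1)[of x] rate_from_end[of "u x"]
    by (simp_all add: du h_def rate_def)
  have in_Omega: "(u x, h x) \<in> Omega M" for x
    using path_in_Omega u(1) by (simp add: h_def less_imp_le)
  have "traveling_wave M (um, hm) (up, hp) u h"
    unfolding traveling_wave_def prod.case Let_def speed
    by (intro conjI allI impI exI[of _ N];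
        (fact in_Omega u_diff u_eq h_cont \<open>finite N\<close> u_bot u_top h_bot h_top du_bot du_top
          dh_bot dh_top | use um_less_up h_eq dec in simp))
  then show ?thesis by blast
qed

end

theorem theorem4p5:
  fixes M :: traffic_model and um hm up hp :: real
  assumes "hysteresis_traffic_model M"
    and "(um, hm) \<in> Omega M"
    and "um < up" and "up = uA M hp"
    and "hm < hp"
    and "uD M hm \<le> um" and "um < uA M hm"
    and "\<forall>u\<in>{um<..<up}.
           (velocity M up hp - velocity M um hm) / (up - um)
             > (velocity M u hm - velocity M um hm) / (u - um)"
    and "\<forall>u\<in>{um<..<up}. u0A M \<le> u \<longrightarrow>
           (velocity M up hp - velocity M um hm) / (up - um)
             > (vA M u - velocity M um hm) / (u - um)"
  shows "\<exists>u h. traveling_wave M (um, hm) (up, hp) u h"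
proof -
  interpret accelerating_shock M um hm up hp
    using assms by unfold_locales auto
  show ?thesis by (rule accelerating_wave_exists)
qed

end
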